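(* Let $0<p\le 1$ and let $\mathbf{X}\in\mathbb{R}^{m\times n}$ have rank $r$. Then $$\|\mathbf{X}\|_{\mathcal{S}_p}^p=\min_{d\in\mathbb{N}_+}\ \min_{\substack{\mathbf{U}\in\mathbb{R}^{m\times d},\ \mathbf{V}\in\mathbb{R}^{n\times d}\\ \mathbf{U}\mathbf{V}^\top=\mathbf{X}}}\ \sum_{i=1}^d\|\mathbf{u}_i\|_2^p\,\|\mathbf{v}_i\|_2^p=\min_{d\in\mathbb{N}_+}\ \min_{\substack{\mathbf{U}\in\mathbb{R}^{m\times d},\ \mathbf{V}\in\mathbb{R}^{n\times d}\\ \mathbf{U}\mathbf{V}^\top=\mathbf{X}}}\ \frac{1}{2^p}\sum_{i=1}^d\left(\|\mathbf{u}_i\|_2^2+\|\mathbf{v}_i\|_2^2\right)^p,$$ where $\mathbf{u}_i$ and $\mathbf{v}_i$ denote the $i$-th columns of $\mathbf{U}$ and $\mathbf{V}$.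
   Context: The Schatten-$p$ quasi-norm raised to the power $p$ is $\|\mathbf{X}\|_{\mathcal{S}_p}^p=\sum_{i}\sigma_i(\mathbf{X})^p$, where the sum runs over the (nonzero) singular values $\sigma_i(\mathbf{X})$ of $\mathbf{X}$. $\mathbb{N}_+$ denotes the positive integers, and $\|\cdot\|_2$ the Euclidean norm. The inner minimum is over pairs of factors with $d$ columns satisfying $\mathbf{U}\mathbf{V}^\top=\mathbf{X}$; values of $d$ for which no such pair exists (those with $d<r$) are disregarded (the minimum over an empty set is $+\infty$). *)

theory Defs
  imports
    "Jordan_Normal_Form.Char_Poly"
    "Jordan_Normal_Form.DL_Rank"
    "HOL-Library.Multiset"
    "HOL-Library.Extended_Real"
begin

text \<open>Singular values with multiplicity: square roots of the eigenvalues of \<open>X\<^sup>T X\<close>, counted with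
  algebraic multiplicity. There are \<open>dim_col X\<close> of them, so this differs from the list of
  \<open>min m n\<close> singular values at most in the number of zeros.\<close>

definition singular_values :: "real mat \<Rightarrow> real multiset" where
  "singular_values X = image_mset sqrt (proots (char_poly (transpose_mat X * X)))"

definition schatten_pow :: "real \<Rightarrow> real mat \<Rightarrow> real" where
  "schatten_pow p X = (\<Sum>\<sigma>\<in>#filter_mset (\<lambda>\<sigma>. \<sigma> \<noteq> 0) (singular_values X). \<sigma> powr p)"

definition l2_norm :: "real vec \<Rightarrow> real" where
  "l2_norm v = sqrt (v \<bullet> v)"

definition factorizations :: "real mat \<Rightarrow> nat \<Rightarrow> (real mat \<times> real mat) set" where
  "factorizations X d = {(U, V). U \<in> carrier_mat (dim_row X) d \<and> V \<in> carrier_mat (dim_col X) d \<and>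
     U * transpose_mat V = X}"

text \<open>Column indices run over \<open>0, \<dots>, d - 1\<close>. For \<open>p > 0\<close> the convention \<open>0 powr p = 0\<close> is the
  intended value.\<close>

definition product_cost :: "real \<Rightarrow> nat \<Rightarrow> real mat \<times> real mat \<Rightarrow> real" where
  "product_cost p d = (\<lambda>(U, V). \<Sum>i<d. l2_norm (col U i) powr p * l2_norm (col V i) powr p)"

definition sum_cost :: "real \<Rightarrow> nat \<Rightarrow> real mat \<times> real mat \<Rightarrow> real" where
  "sum_cost p d = (\<lambda>(U, V). 1 / 2 powr p *
     (\<Sum>i<d. ((l2_norm (col U i))\<^sup>2 + (l2_norm (col V i))\<^sup>2) powr p))"

text \<open>\<open>has_min f S v\<close>: the minimum of \<open>f\<close> over \<open>S\<close> is \<open>v\<close>. The minimum must be attained, except that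
  the minimum over the empty set is \<open>\<infinity>\<close>.\<close>

definition has_min :: "('a \<Rightarrow> ereal) \<Rightarrow> 'a set \<Rightarrow> ereal \<Rightarrow> bool" where
  "has_min f S v \<longleftrightarrow>
     (if S = {} then v = \<infinity> else (\<exists>x\<in>S. f x = v) \<and> (\<forall>x\<in>S. v \<le> f x))"

lemma has_min_unique: "has_min f S v \<Longrightarrow> has_min f S w \<Longrightarrow> v = w"
  unfolding has_min_def by (metis order_antisym)

text \<open>\<open>v\<close> is the iterated minimum of the cost \<open>c d\<close>: first over the factorizations of \<open>X\<close> with \<open>d\<close>
  columns, then over all \<open>d \<ge> 1\<close>. Here \<open>g d\<close> is the inner minimum.\<close>

definition min_over_factorizations ::
    "(nat \<Rightarrow> real mat \<times> real mat \<Rightarrow> real) \<Rightarrow> real mat \<Rightarrow> real \<Rightarrow> bool" where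
  "min_over_factorizations c X v \<longleftrightarrow>
     (\<exists>g. (\<forall>d\<ge>1. has_min (\<lambda>UV. ereal (c d UV)) (factorizations X d) (g d)) \<and>
          has_min g {1..} (ereal v))"

end

theory Submission
  imports Defs "HOL-Analysis.Convex"
begin

text \<open>
  The lower bound is the heart of the matter. Let \<open>X = \<Sum>\<^sub>i \<sigma>\<^sub>i a\<^sub>i b\<^sub>i\<^sup>T\<close> be a singular value decomposition
  with \<open>N\<close> nonzero singular values, and let \<open>X = U V\<^sup>T = \<Sum>\<^sub>j u\<^sub>j v\<^sub>j\<^sup>T\<close>. In the coordinates of the \<open>a\<^sub>i\<close> and
  the \<open>b\<^sub>i\<close> the factorization becomes one of the diagonal matrix \<open>\<Sigma> = diag \<sigma>\<close>, and by Bessel's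
  inequality no column gets longer. So it is enough to bound \<open>\<Sum>\<^sub>i \<sigma>\<^sub>i\<^sup>p\<close> by \<open>\<Sum>\<^sub>j c\<^sub>j\<^sup>p\<close> with
  \<open>c\<^sub>j = \<parallel>u\<^sub>j\<parallel> \<parallel>v\<^sub>j\<parallel>\<close> when \<open>U V\<^sup>T = \<Sigma>\<close>.

  For \<open>p < 1\<close> duality is not available, since the quasi-norm is not convex. Instead, number the columns
  so that \<open>c\<close> decreases, and choose an orthonormal basis \<open>s\<^sub>0, \<dots>, s\<^bsub>N-1\<^esub>\<close> of \<open>\<real>\<^sup>N\<close> such that \<open>s\<^sub>i\<close> is
  orthogonal to \<open>v\<^sub>j\<close> for all \<open>j < i\<close>. Then \<open>h\<^sub>i = s\<^sub>i\<^sup>T \<Sigma> s\<^sub>i = \<Sum>\<^sub>j w\<^sub>i\<^sub>j\<close>, where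
  \<open>w\<^sub>i\<^sub>j = (s\<^sub>i \<bullet> u\<^sub>j) (s\<^sub>i \<bullet> v\<^sub>j)\<close> vanishes for \<open>j < i\<close> and satisfies \<open>\<Sum>\<^sub>i \<bar>w\<^sub>i\<^sub>j\<bar> \<le> c\<^sub>j\<close>. The tangent of the
  concave function \<open>x\<^sup>p\<close> at \<open>c\<^sub>i\<close> gives \<open>\<sigma>\<^sub>l\<^sup>p \<le> (1 - p) c\<^sub>i\<^sup>p + p c\<^sub>i\<^bsup>p-1\<^esup> \<sigma>\<^sub>l\<close>. Averaging this with the
  doubly stochastic weights \<open>(s\<^sub>i)\<^sub>l\<^sup>2\<close> yields
  \<open>\<Sum>\<^sub>l \<sigma>\<^sub>l\<^sup>p \<le> (1 - p) \<Sum>\<^bsub>i<N\<^esub> c\<^sub>i\<^sup>p + p \<Sum>\<^sub>i c\<^sub>i\<^bsup>p-1\<^esup> h\<^sub>i\<close>.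
  Since \<open>w\<^sub>i\<^sub>j\<close> is nonzero only for \<open>i \<le> j\<close>, where \<open>c\<^sub>i\<^bsup>p-1\<^esup> \<le> c\<^sub>j\<^bsup>p-1\<^esup>\<close>, the last sum is at most
  \<open>\<Sum>\<^sub>j c\<^sub>j\<^bsup>p-1\<^esup> c\<^sub>j = \<Sum>\<^sub>j c\<^sub>j\<^sup>p\<close>. The same argument shows \<open>c\<^sub>i > 0\<close> for all \<open>i < N\<close>, hence \<open>N \<le> d\<close>. This is
  \<open>diagonal_factorization_bound_sorted\<close>.

  Both costs attain the bound at the balanced factors with columns \<open>\<surd>\<sigma>\<^sub>i a\<^sub>i\<close> and \<open>\<surd>\<sigma>\<^sub>i b\<^sub>i\<close>, padded with
  zero columns, as soon as \<open>d \<ge> N\<close>; and the second cost dominates the first by the inequality between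
  the arithmetic and the geometric mean. So for each \<open>d\<close> the inner minimum is either the Schatten value
  or, when \<open>d < N\<close>, infinite because there is no factorization.

  The singular value decomposition comes from the spectral theorem for \<open>X\<^sup>T X\<close>. It is proved here by
  deflation: a symmetric matrix has a real eigenvector, found over the complex numbers, and its
  compression to the orthogonal complement of the eigenvectors already found is again symmetric.
\<close>

section \<open>Orthonormal families of coordinate vectors\<close>

text \<open>Vectors are coordinate functions of which only the first \<open>n\<close> values count. With families indexed by
  natural numbers, changes of basis and truncations become manipulations of finite double sums.\<close>

definition orthonormal :: "nat \<Rightarrow> nat \<Rightarrow> (nat \<Rightarrow> nat \<Rightarrow> real) \<Rightarrow> bool" where
  "orthonormal N n s \<longleftrightarrow> (\<forall>i<N. \<forall>k<N. (\<Sum>l<n. s i l * s k l) = (if i = k then 1 else 0))"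

lemma orthonormalD:
  "orthonormal N n s \<Longrightarrow> i < N \<Longrightarrow> k < N \<Longrightarrow> (\<Sum>l<n. s i l * s k l) = (if i = k then 1 else 0)"
  by (simp add: orthonormal_def)

text \<open>With \<open>y\<close> the projection of \<open>z\<close> to the span of the family, both \<open>z \<bullet> y\<close> and \<open>y \<bullet> y\<close> equal the
  left-hand side, and the claim is \<open>0 \<le> \<parallel>z - y\<parallel>\<^sup>2\<close>.\<close>

lemma bessel_inequality:
  assumes "orthonormal N n s"
  shows "(\<Sum>i<N. (\<Sum>l<n. s i l * z l)\<^sup>2) \<le> (\<Sum>l<n. (z l)\<^sup>2)"
proof -
  define c where "c i = (\<Sum>l<n. s i l * z l)" for i
  define y where "y l = (\<Sum>i<N. c i * s i l)" for l
  have zy: "(\<Sum>l<n. z l * y l) = (\<Sum>i<N. (c i)\<^sup>2)"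
  proof -
    have "(\<Sum>l<n. z l * y l) = (\<Sum>l<n. \<Sum>i<N. c i * (s i l * z l))"
      by (simp add: y_def sum_distrib_left mult_ac)
    also have "\<dots> = (\<Sum>i<N. \<Sum>l<n. c i * (s i l * z l))" by (rule sum.swap)
    also have "\<dots> = (\<Sum>i<N. (c i)\<^sup>2)"
      by (simp add: sum_distrib_left[symmetric] c_def power2_eq_square)
    finally show ?thesis .
  qed
  have yy: "(\<Sum>l<n. (y l)\<^sup>2) = (\<Sum>i<N. (c i)\<^sup>2)"
  proof -
    have "(\<Sum>l<n. (y l)\<^sup>2) = (\<Sum>l<n. \<Sum>i<N. c i * (s i l * y l))"
    proof (rule sum.cong[OF refl])
      fix l
      have "(y l)\<^sup>2 = (\<Sum>i<N. c i * s i l) * y l" by (simp add: y_def power2_eq_square)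
      also have "\<dots> = (\<Sum>i<N. c i * (s i l * y l))"
        by (simp add: sum_distrib_right mult.assoc)
      finally show "(y l)\<^sup>2 = (\<Sum>i<N. c i * (s i l * y l))" .
    qed
    also have "\<dots> = (\<Sum>i<N. \<Sum>l<n. c i * (s i l * y l))" by (rule sum.swap)
    also have "\<dots> = (\<Sum>i<N. c i * (\<Sum>l<n. s i l * y l))"
      by (simp add: sum_distrib_left)
    also have "\<dots> = (\<Sum>i<N. c i * c i)"
    proof (rule sum.cong[OF refl])
      fix i assume i: "i \<in> {..<N}"
      have "(\<Sum>l<n. s i l * y l) = (\<Sum>l<n. \<Sum>k<N. c k * (s i l * s k l))"
        by (simp add: y_def sum_distrib_left mult_ac)
      also have "\<dots> = (\<Sum>k<N. \<Sum>l<n. c k * (s i l * s k l))" by (rule sum.swap)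
      also have "\<dots> = (\<Sum>k<N. c k * (if i = k then 1 else 0))"
        using i by (intro sum.cong) (auto simp: sum_distrib_left[symmetric] orthonormalD[OF assms])
      also have "\<dots> = c i" using i by (simp add: if_distrib cong: if_cong)
      finally show "c i * (\<Sum>l<n. s i l * y l) = c i * c i" by simp
    qed
    finally show ?thesis by (simp add: power2_eq_square)
  qed
  have "0 \<le> (\<Sum>l<n. (z l - y l)\<^sup>2)" by (intro sum_nonneg) auto
  also have "\<dots> = (\<Sum>l<n. (z l)\<^sup>2) - 2 * (\<Sum>l<n. z l * y l) + (\<Sum>l<n. (y l)\<^sup>2)"
    by (simp add: power2_diff sum.distrib sum_subtractf sum_distrib_left mult_ac)
  finally show ?thesis using zy yy by (simp add: c_def)
qed

lemma orthonormal_columns: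
  assumes "orthonormal n n s" "l < n" "m < n"
  shows "(\<Sum>i<n. s i l * s i m) = (if l = m then 1 else 0)"
proof -
  define Y where "Y = mat n n (\<lambda>(i, l). s i l)"
  have Y: "Y \<in> carrier_mat n n" by (simp add: Y_def)
  have "Y * transpose_mat Y = 1\<^sub>m n"
    using assms(1) by (intro eq_matI)
      (auto simp: Y_def scalar_prod_def orthonormal_def lessThan_atLeast0)
  then have "transpose_mat Y * Y = 1\<^sub>m n"
    using mat_mult_left_right_inverse[of Y n "transpose_mat Y"] Y by auto
  then have "(transpose_mat Y * Y) $$ (l, m) = 1\<^sub>m n $$ (l, m)" by simp
  then show ?thesis using assms by (simp add: Y_def scalar_prod_def lessThan_atLeast0)
qed

text \<open>A square matrix whose rows are the given vectors followed by at least one zero row is singular; normalize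
  a vector of its kernel.\<close>

lemma unit_vector_orthogonal_to_fewer:
  fixes w :: "nat \<Rightarrow> nat \<Rightarrow> real"
  assumes "k < n"
  obtains z where "(\<Sum>l<n. z l * z l) = 1" "\<And>j. j < k \<Longrightarrow> (\<Sum>l<n. z l * w j l) = 0"
proof -
  define M where "M = mat n n (\<lambda>(j, l). if j < k then w j l else 0)"
  have M: "M \<in> carrier_mat n n" by (simp add: M_def)
  \<comment> \<open>Row \<open>k\<close> is zero, so scaling it by zero changes nothing.\<close>
  have "multrow k 0 M = M" using assms by (intro eq_matI) (auto simp: M_def)
  then have "det M = 0" using det_multrow[OF assms M, of 0] by simp
  then obtain v where v: "v \<in> carrier_vec n" "v \<noteq> 0\<^sub>v n" "M *\<^sub>v v = 0\<^sub>v n"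
    using det_0_iff_vec_prod_zero[OF M] by auto
  define q where "q = (\<Sum>l<n. (v $ l)\<^sup>2)"
  obtain l where "l < n" "v $ l \<noteq> 0" using v(1,2) by (metis carrier_vecD eq_vecI index_zero_vec)
  then have q: "q > 0" unfolding q_def by (intro sum_pos2[where i = l]) auto
  show thesis
  proof (rule that)
    show "(\<Sum>l<n. v $ l / sqrt q * (v $ l / sqrt q)) = 1"
      using q by (simp add: sum_divide_distrib[symmetric] q_def power2_eq_square)
    fix j assume j: "j < k"
    then have "(M *\<^sub>v v) $ j = 0" using v assms by simp
    then have "(\<Sum>l<n. v $ l * w j l) = 0"
      using j assms v(1) by (simp add: M_def scalar_prod_def lessThan_atLeast0 mult.commute)
    then show "(\<Sum>l<n. v $ l / sqrt q * w j l) = 0"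
      by (simp add: sum_divide_distrib[symmetric])
  qed
qed

text \<open>The transposed \<open>Q\<close> factor of a QR decomposition, built from the last vector downwards. The vector
  \<open>s\<^sub>i\<close> has to be orthogonal to \<open>w\<^sub>0, \<dots>, w\<^bsub>i-1\<^esub>\<close> and to the vectors \<open>s\<^bsub>i+1\<^esub>, \<dots>, s\<^bsub>n-1\<^esub>\<close> chosen before, and
  these are \<open>n - 1\<close> conditions whatever \<open>i\<close> is.\<close>

lemma orthonormal_basis_adapted_to_flag:
  fixes w :: "nat \<Rightarrow> nat \<Rightarrow> real"
  obtains s where "orthonormal n n s" "\<And>i j. i < n \<Longrightarrow> j < i \<Longrightarrow> (\<Sum>l<n. s i l * w j l) = 0"
proof -
  have "\<exists>s. (\<forall>i\<in>{n-t..<n}. \<forall>k\<in>{n-t..<n}. (\<Sum>l<n. s i l * s k l) = (if i = k then 1 else 0)) \<and>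
     (\<forall>i\<in>{n-t..<n}. \<forall>j<i. (\<Sum>l<n. s i l * w j l) = 0)" if "t \<le> n" for t
    using that
  proof (induction t)
    case 0
    then show ?case by auto
  next
    case (Suc t)
    then obtain s where s: "\<forall>i\<in>{n-t..<n}. \<forall>k\<in>{n-t..<n}. (\<Sum>l<n. s i l * s k l) = (if i = k then 1 else 0)"
      "\<forall>i\<in>{n-t..<n}. \<forall>j<i. (\<Sum>l<n. s i l * w j l) = 0" by auto
    define i0 where "i0 = n - Suc t"
    have i0: "i0 < n" "n - t = Suc i0" using Suc.prems by (auto simp: i0_def)
    \<comment> \<open>Condition \<open>j\<close> with \<open>j \<ge> i0\<close> is about \<open>s (Suc j)\<close>: the index \<open>i0\<close> itself is skipped.\<close>
    obtain z where z: "(\<Sum>l<n. z l * z l) = 1"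
      "\<And>j. j < n - 1 \<Longrightarrow> (\<Sum>l<n. z l * (if j < i0 then w j else s (Suc j)) l) = 0"
      using unit_vector_orthogonal_to_fewer[of "n - 1" n "\<lambda>j. if j < i0 then w j else s (Suc j)"] i0
      by (metis diff_less less_one less_nat_zero_code neq0_conv)
    have zw: "(\<Sum>l<n. z l * w j l) = 0" if "j < i0" for j
      using z(2)[of j] that i0 by simp
    have zs: "(\<Sum>l<n. z l * s j l) = 0" if "j \<in> {Suc i0..<n}" for j
    proof -
      have "\<not> j - 1 < i0" "Suc (j - 1) = j" "j - 1 < n - 1" using that by auto
      then show ?thesis using z(2)[of "j - 1"] by simp
    qed
    have zs': "(\<Sum>l<n. s j l * z l) = 0" if "j \<in> {Suc i0..<n}" for j
      using zs[OF that] by (simp add: mult.commute)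
    have "{n - Suc t..<n} = insert i0 {Suc i0..<n}" using i0 by (auto simp: i0_def)
    then show ?case
      using s z(1) zw zs zs' unfolding i0
      by (intro exI[of _ "s(i0 := z)"]) auto
  qed
  from this[OF order_refl] obtain s where
    "\<forall>i\<in>{0..<n}. \<forall>k\<in>{0..<n}. (\<Sum>l<n. s i l * s k l) = (if i = k then 1 else 0)"
    "\<forall>i\<in>{0..<n}. \<forall>j<i. (\<Sum>l<n. s i l * w j l) = 0" by auto
  then show thesis by (intro that[of s]) (simp_all add: orthonormal_def)
qed

text \<open>In an orthonormal basis adapted to the flag of the \<open>w\<^sub>j\<close>, all members with index at least \<open>k\<close> are
  orthogonal to every \<open>w\<^sub>j\<close>, so that they complete the family.\<close>

lemma orthonormal_extend:
  assumes w: "orthonormal k n w"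
  obtains s where "orthonormal n n s" "\<And>i. i < k \<Longrightarrow> s i = w i"
proof -
  obtain u where u: "orthonormal n n u"
    and flag: "\<And>i j. i < n \<Longrightarrow> j < i \<Longrightarrow> (\<Sum>l<n. u i l * w j l) = 0"
    using orthonormal_basis_adapted_to_flag[of n w] by blast
  have flag': "(\<Sum>l<n. w j l * u i l) = 0" if "i < n" "j < i" for i j
    using flag[OF that] by (simp add: mult.commute)
  show thesis
  proof (rule that)
    show "orthonormal n n (\<lambda>i. if i < k then w i else u i)"
      using orthonormalD[OF w] orthonormalD[OF u] flag flag' by (auto simp: orthonormal_def)
  qed simp
qed

text \<open>An orthonormal basis separates vectors, because it reproduces each vector from its coefficients.\<close>

lemma orthonormal_eqI:
  assumes s: "orthonormal n n s"
    and "\<And>i. i < n \<Longrightarrow> (\<Sum>l<n. s i l * x l) = (\<Sum>l<n. s i l * y l)" and m: "m < n"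
  shows "x m = (y m :: real)"
proof -
  have expand: "x m = (\<Sum>i<n. s i m * (\<Sum>l<n. s i l * x l))" for x :: "nat \<Rightarrow> real"
  proof -
    have "(\<Sum>i<n. s i m * (\<Sum>l<n. s i l * x l)) = (\<Sum>i<n. \<Sum>l<n. s i m * s i l * x l)"
      by (simp add: sum_distrib_left mult.assoc)
    also have "\<dots> = (\<Sum>l<n. \<Sum>i<n. s i m * s i l * x l)" by (rule sum.swap)
    also have "\<dots> = (\<Sum>l<n. (if m = l then 1 else 0) * x l)"
      by (intro sum.cong refl) (simp add: sum_distrib_right[symmetric] orthonormal_columns[OF s m])
    also have "\<dots> = x m" using m by (simp add: if_distrib if_distribR cong: if_cong)
    finally show ?thesis by simp
  qed
  show ?thesis using assms(2) by (simp add: expand[of x] expand[of y])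
qed

section \<open>The power-sum inequality for a factored diagonal matrix\<close>

text \<open>The right-hand side is the tangent of the concave function \<open>x\<^sup>p\<close> at \<open>y\<close>. It is Young's inequality
  \<open>x\<^sup>p y\<^bsup>1-p\<^esup> \<le> p x + (1 - p) y\<close> divided by \<open>y\<^bsup>1-p\<^esup>\<close>.\<close>

lemma powr_le_tangent:
  fixes x y p :: real
  assumes "0 < p" "p \<le> 1" "0 < x" "0 < y"
  shows "x powr p \<le> (1 - p) * y powr p + p * y powr (p - 1) * x"
proof -
  have "x powr p * y powr (1 - p) \<le> p * x + (1 - p) * y"
    using assms by (intro Youngs_inequality_0) auto
  then have "x powr p * y powr (1 - p) * y powr (p - 1) \<le> (p * x + (1 - p) * y) * y powr (p - 1)"
    by (rule mult_right_mono) auto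
  moreover have "y powr (1 - p) * y powr (p - 1) = 1" "y * y powr (p - 1) = y powr p"
    using assms by (simp_all add: powr_add[symmetric] powr_mult_base)
  ultimately show ?thesis by (simp add: algebra_simps)
qed

text \<open>The columns of the two factors of \<open>diag \<sigma>\<close> are indexed by \<open>j\<close>, with norms at most \<open>A j\<close> and \<open>B j\<close>. The
  decreasing order of \<open>c j = A j * B j\<close> is matched to the triangular shape that the adapted basis gives
  to \<open>P i j * Q i j\<close>: a column \<open>j\<close> contributes only to indices \<open>i \<le> j\<close>, where \<open>c i \<ge> c j\<close>.\<close>

lemma diagonal_factorization_bound_sorted:
  fixes \<alpha> \<beta> :: "nat \<Rightarrow> nat \<Rightarrow> real" and \<sigma> A B :: "nat \<Rightarrow> real"
  assumes p: "0 < p" "p \<le> 1"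
    and \<sigma>: "\<And>i. i < N \<Longrightarrow> 0 < \<sigma> i"
    and diag: "\<And>i l. i < N \<Longrightarrow> l < N \<Longrightarrow> (\<Sum>j<d. \<alpha> i j * \<beta> l j) = (if i = l then \<sigma> i else 0)"
    and A: "\<And>j. j < d \<Longrightarrow> 0 \<le> A j" "\<And>j. j < d \<Longrightarrow> (\<Sum>i<N. (\<alpha> i j)\<^sup>2) \<le> (A j)\<^sup>2"
    and B: "\<And>j. j < d \<Longrightarrow> 0 \<le> B j" "\<And>j. j < d \<Longrightarrow> (\<Sum>i<N. (\<beta> i j)\<^sup>2) \<le> (B j)\<^sup>2"
    and sorted: "\<And>i j. i \<le> j \<Longrightarrow> j < d \<Longrightarrow> A j * B j \<le> A i * B i"
  shows "N \<le> d \<and> (\<Sum>i<N. \<sigma> i powr p) \<le> (\<Sum>j<d. (A j * B j) powr p)"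
proof -
  define c where "c j = A j * B j" for j
  have c0: "0 \<le> c j" if "j < d" for j using A(1) B(1) that by (simp add: c_def)
  \<comment> \<open>There may be fewer than \<open>N\<close> columns at this point; missing ones impose no condition.\<close>
  obtain s where s: "orthonormal N N s"
    and flag: "\<And>i j. i < N \<Longrightarrow> j < i \<Longrightarrow> (\<Sum>l<N. s i l * (if j < d then \<beta> l j else 0)) = 0"
    using orthonormal_basis_adapted_to_flag[of N "\<lambda>j l. if j < d then \<beta> l j else 0"] by blast
  define P where "P i j = (\<Sum>l<N. s i l * \<alpha> l j)" for i j
  define Q where "Q i j = (\<Sum>l<N. s i l * \<beta> l j)" for i j
  define h where "h i = (\<Sum>l<N. (s i l)\<^sup>2 * \<sigma> l)" for i
  have Q0: "Q i j = 0" if "i < N" "j < i" "j < d" for i j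
    using flag[of i j] that by (simp add: Q_def)
  have srow: "(\<Sum>l<N. (s i l)\<^sup>2) = 1" if "i < N" for i
    using orthonormalD[OF s that that] by (simp add: power2_eq_square)
  have scol: "(\<Sum>i<N. (s i l)\<^sup>2) = 1" if "l < N" for l
    using orthonormal_columns[OF s that that] by (simp add: power2_eq_square)
  have h_eq: "h i = (\<Sum>j<d. P i j * Q i j)" if "i < N" for i
  proof -
    have "(\<Sum>j<d. P i j * Q i j) = (\<Sum>j<d. \<Sum>l<N. \<Sum>m<N. s i l * s i m * (\<alpha> l j * \<beta> m j))"
      by (simp add: P_def Q_def sum_product mult_ac)
    also have "\<dots> = (\<Sum>l<N. \<Sum>j<d. \<Sum>m<N. s i l * s i m * (\<alpha> l j * \<beta> m j))"
      by (rule sum.swap)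
    also have "\<dots> = (\<Sum>l<N. \<Sum>m<N. \<Sum>j<d. s i l * s i m * (\<alpha> l j * \<beta> m j))"
      by (intro sum.cong refl sum.swap)
    also have "\<dots> = (\<Sum>l<N. \<Sum>m<N. s i l * s i m * (if l = m then \<sigma> l else 0))"
      by (intro sum.cong refl) (simp add: sum_distrib_left[symmetric] diag)
    also have "\<dots> = h i"
      by (simp add: h_def if_distrib power2_eq_square cong: if_cong)
    finally show ?thesis by simp
  qed
  \<comment> \<open>\<open>\<Sigma>\<close> is positive definite.\<close>
  have hpos: "0 < h i" if i: "i < N" for i
  proof -
    have "\<exists>l<N. s i l \<noteq> 0"
    proof (rule ccontr)
      assume "\<not> (\<exists>l<N. s i l \<noteq> 0)"
      then have "(\<Sum>l<N. (s i l)\<^sup>2) = 0" by simp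
      then show False using srow[OF i] by simp
    qed
    then obtain l where "l < N" "s i l \<noteq> 0" by auto
    then show ?thesis unfolding h_def using \<sigma> less_imp_le[OF \<sigma>]
      by (intro sum_pos2[where i = l]) auto
  qed
  \<comment> \<open>Cauchy--Schwarz in \<open>i\<close>, then Bessel for each of the two columns with index \<open>j\<close>.\<close>
  have PQ: "(\<Sum>i<N. \<bar>P i j * Q i j\<bar>) \<le> c j" if j: "j < d" for j
  proof -
    have 1: "(\<Sum>i<N. (P i j)\<^sup>2) \<le> (A j)\<^sup>2"
      using bessel_inequality[OF s, of "\<lambda>l. \<alpha> l j"] A(2)[OF j] by (simp add: P_def)
    have 2: "(\<Sum>i<N. (Q i j)\<^sup>2) \<le> (B j)\<^sup>2"
      using bessel_inequality[OF s, of "\<lambda>l. \<beta> l j"] B(2)[OF j] by (simp add: Q_def)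
    have "(\<Sum>i<N. \<bar>P i j\<bar> * \<bar>Q i j\<bar>)\<^sup>2 \<le> (\<Sum>i<N. \<bar>P i j\<bar>\<^sup>2) * (\<Sum>i<N. \<bar>Q i j\<bar>\<^sup>2)"
      by (rule Cauchy_Schwarz_ineq_sum)
    also have "\<dots> \<le> (A j)\<^sup>2 * (B j)\<^sup>2"
      using 1 2 by (intro mult_mono) (auto intro: sum_nonneg)
    finally have "(\<Sum>i<N. \<bar>P i j\<bar> * \<bar>Q i j\<bar>)\<^sup>2 \<le> (c j)\<^sup>2" by (simp add: c_def power_mult_distrib)
    then show ?thesis unfolding abs_mult using c0[OF j] by (rule power2_le_imp_le)
  qed
  \<comment> \<open>Some column \<open>j \<ge> i\<close> has to contribute to \<open>h i > 0\<close>, and \<open>c i \<ge> c j\<close>.\<close>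
  have cpos: "i < d \<and> 0 < c i" if i: "i < N" for i
  proof -
    have "\<exists>j<d. P i j * Q i j \<noteq> 0"
    proof (rule ccontr)
      assume "\<not> (\<exists>j<d. P i j * Q i j \<noteq> 0)"
      then have "(\<Sum>j<d. P i j * Q i j) = 0" by (intro sum.neutral) auto
      then show False using hpos[OF i] h_eq[OF i] by simp
    qed
    then obtain j where j: "j < d" "P i j * Q i j \<noteq> 0" by auto
    then have ij: "i \<le> j" using Q0[OF i, of j] by force
    have "0 < \<bar>P i j * Q i j\<bar>" using j by simp
    also have "\<dots> \<le> (\<Sum>i<N. \<bar>P i j * Q i j\<bar>)" using i
      by (intro member_le_sum) auto
    also have "\<dots> \<le> c j" by (rule PQ[OF j(1)])
    also have "\<dots> \<le> c i" using sorted[OF ij j(1)] by (simp add: c_def)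
    finally show ?thesis using ij j by simp
  qed
  have Nd: "N \<le> d" using cpos[of "N - 1"] by (cases N) auto
  \<comment> \<open>Where column \<open>j\<close> contributes, \<open>0 < c j \<le> c i\<close>, and the exponent \<open>p - 1\<close> reverses the order.\<close>
  have weighted: "c i powr (p - 1) * h i \<le> (\<Sum>j<d. c j powr (p - 1) * \<bar>P i j * Q i j\<bar>)"
    if i: "i < N" for i
  proof -
    have "c i powr (p - 1) * h i = (\<Sum>j<d. c i powr (p - 1) * (P i j * Q i j))"
      using h_eq[OF i] by (simp add: sum_distrib_left)
    also have "\<dots> \<le> (\<Sum>j<d. c j powr (p - 1) * \<bar>P i j * Q i j\<bar>)"
    proof (rule sum_mono)
      fix j assume "j \<in> {..<d}"
      then have j: "j < d" by simp
      show "c i powr (p - 1) * (P i j * Q i j) \<le> c j powr (p - 1) * \<bar>P i j * Q i j\<bar>"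
      proof (cases "P i j * Q i j = 0")
        case False
        then have ij: "i \<le> j" using Q0[OF i _ j] by force
        have "0 < \<bar>P i j * Q i j\<bar>" using False by simp
        also have "\<dots> \<le> (\<Sum>i<N. \<bar>P i j * Q i j\<bar>)" using i
          by (intro member_le_sum) auto
        also have "\<dots> \<le> c j" by (rule PQ[OF j])
        finally have "0 < c j" .
        moreover have "c j \<le> c i" using sorted[OF ij j] by (simp add: c_def)
        ultimately have "c i powr (p - 1) \<le> c j powr (p - 1)"
          using p by (intro powr_mono2') auto
        then have "c i powr (p - 1) * \<bar>P i j * Q i j\<bar> \<le> c j powr (p - 1) * \<bar>P i j * Q i j\<bar>"
          by (rule mult_right_mono) auto
        moreover have "c i powr (p - 1) * (P i j * Q i j) \<le> c i powr (p - 1) * \<bar>P i j * Q i j\<bar>"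
          by (rule mult_left_mono) auto
        ultimately show ?thesis by linarith
      next
        case True
        then show ?thesis unfolding True by simp
      qed
    qed
    finally show ?thesis .
  qed
  \<comment> \<open>The weights \<open>(s i l)\<^sup>2\<close> are doubly stochastic: \<open>scol\<close> introduces them, \<open>srow\<close> removes them.\<close>
  have "(\<Sum>i<N. \<sigma> i powr p) = (\<Sum>l<N. \<sigma> l powr p * (\<Sum>i<N. (s i l)\<^sup>2))"
    using scol by simp
  also have "\<dots> = (\<Sum>i<N. \<Sum>l<N. (s i l)\<^sup>2 * \<sigma> l powr p)"
    by (simp add: sum_distrib_left mult.commute) (rule sum.swap)
  also have "\<dots> \<le> (\<Sum>i<N. \<Sum>l<N. (s i l)\<^sup>2 * ((1 - p) * c i powr p + p * c i powr (p - 1) * \<sigma> l))"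
    using cpos \<sigma> p by (intro sum_mono mult_left_mono powr_le_tangent) auto
  also have "\<dots> = (\<Sum>i<N. (1 - p) * c i powr p + p * (c i powr (p - 1) * h i))"
  proof (rule sum.cong[OF refl])
    fix i assume "i \<in> {..<N}"
    have "(\<Sum>l<N. (s i l)\<^sup>2 * ((1 - p) * c i powr p + p * c i powr (p - 1) * \<sigma> l)) =
      (\<Sum>l<N. (s i l)\<^sup>2) * ((1 - p) * c i powr p) + p * c i powr (p - 1) * h i"
      by (simp add: h_def ring_distribs sum.distrib sum_distrib_left sum_distrib_right mult_ac)
    then show "(\<Sum>l<N. (s i l)\<^sup>2 * ((1 - p) * c i powr p + p * c i powr (p - 1) * \<sigma> l)) =
        (1 - p) * c i powr p + p * (c i powr (p - 1) * h i)"
      using srow \<open>i \<in> {..<N}\<close> by simp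
  qed
  also have "\<dots> \<le> (\<Sum>i<N. (1 - p) * c i powr p + p * (\<Sum>j<d. c j powr (p - 1) * \<bar>P i j * Q i j\<bar>))"
    using weighted p by (intro sum_mono add_mono mult_left_mono) auto
  also have "\<dots> = (1 - p) * (\<Sum>i<N. c i powr p)
      + p * (\<Sum>i<N. \<Sum>j<d. c j powr (p - 1) * \<bar>P i j * Q i j\<bar>)"
    by (simp add: sum.distrib sum_distrib_left)
  also have "(\<Sum>i<N. \<Sum>j<d. c j powr (p - 1) * \<bar>P i j * Q i j\<bar>) =
      (\<Sum>j<d. c j powr (p - 1) * (\<Sum>i<N. \<bar>P i j * Q i j\<bar>))"
    by (subst sum.swap) (simp add: sum_distrib_left)
  also have "(1 - p) * (\<Sum>i<N. c i powr p) + p * \<dots> \<le>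
      (1 - p) * (\<Sum>j<d. c j powr p) + p * (\<Sum>j<d. c j powr p)"
  proof (intro add_mono mult_left_mono)
    show "(\<Sum>i<N. c i powr p) \<le> (\<Sum>j<d. c j powr p)"
      using Nd by (intro sum_mono2) auto
    show "(\<Sum>j<d. c j powr (p - 1) * (\<Sum>i<N. \<bar>P i j * Q i j\<bar>)) \<le> (\<Sum>j<d. c j powr p)"
    proof (rule sum_mono)
      fix j assume "j \<in> {..<d}"
      then have j: "j < d" by simp
      have "c j powr (p - 1) * (\<Sum>i<N. \<bar>P i j * Q i j\<bar>) \<le> c j powr (p - 1) * c j"
        using PQ[OF j] by (rule mult_left_mono) auto
      also have "\<dots> = c j powr p"
        using c0[OF j] p by (cases "c j = 0") (auto simp: powr_mult_base mult.commute)
      finally show "c j powr (p - 1) * (\<Sum>i<N. \<bar>P i j * Q i j\<bar>) \<le> c j powr p" .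
    qed
  qed (use p in auto)
  finally show ?thesis using Nd by (simp add: c_def algebra_simps)
qed

text \<open>Hypotheses and conclusion are invariant under a permutation of the columns, so that sorting them
  loses nothing.\<close>

lemma diagonal_factorization_bound:
  fixes \<alpha> \<beta> :: "nat \<Rightarrow> nat \<Rightarrow> real" and \<sigma> A B :: "nat \<Rightarrow> real"
  assumes p: "0 < p" "p \<le> 1"
    and \<sigma>: "\<And>i. i < N \<Longrightarrow> 0 < \<sigma> i"
    and diag: "\<And>i l. i < N \<Longrightarrow> l < N \<Longrightarrow> (\<Sum>j<d. \<alpha> i j * \<beta> l j) = (if i = l then \<sigma> i else 0)"
    and A: "\<And>j. j < d \<Longrightarrow> 0 \<le> A j" "\<And>j. j < d \<Longrightarrow> (\<Sum>i<N. (\<alpha> i j)\<^sup>2) \<le> (A j)\<^sup>2"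
    and B: "\<And>j. j < d \<Longrightarrow> 0 \<le> B j" "\<And>j. j < d \<Longrightarrow> (\<Sum>i<N. (\<beta> i j)\<^sup>2) \<le> (B j)\<^sup>2"
  shows "N \<le> d \<and> (\<Sum>i<N. \<sigma> i powr p) \<le> (\<Sum>j<d. (A j * B j) powr p)"
proof -
  define js where "js = sort_key (\<lambda>j. - (A j * B j)) [0..<d]"
  define \<pi> where "\<pi> = nth js"
  have len: "length js = d" and set: "set js = {..<d}" and dist: "distinct js"
    by (auto simp: js_def)
  have bij: "bij_betw \<pi> {..<d} {..<d}"
    unfolding \<pi>_def by (rule bij_betw_nth[OF dist]) (use len set in auto)
  have \<pi>: "\<pi> j < d" if "j < d" for j using bij that by (auto simp: bij_betw_def)
  have mono: "A (\<pi> j) * B (\<pi> j) \<le> A (\<pi> i) * B (\<pi> i)" if "i \<le> j" "j < d" for i j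
    using sorted_nth_mono[OF sorted_sort_key[of "\<lambda>j. - (A j * B j)" "[0..<d]", folded js_def], of i j]
      that len by (simp add: \<pi>_def)
  have re: "(\<Sum>j<d. f (\<pi> j)) = (\<Sum>j<d. f j)" for f :: "nat \<Rightarrow> real"
    by (rule sum.reindex_bij_betw[OF bij])
  have "N \<le> d \<and> (\<Sum>i<N. \<sigma> i powr p) \<le> (\<Sum>j<d. (A (\<pi> j) * B (\<pi> j)) powr p)"
  proof (rule diagonal_factorization_bound_sorted[where \<alpha> = "\<lambda>i j. \<alpha> i (\<pi> j)" and \<beta> = "\<lambda>i j. \<beta> i (\<pi> j)"])
    show "(\<Sum>j<d. \<alpha> i (\<pi> j) * \<beta> l (\<pi> j)) = (if i = l then \<sigma> i else 0)" if "i < N" "l < N" for i l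
      using re[of "\<lambda>j. \<alpha> i j * \<beta> l j"] diag[OF that] by simp
  qed (use p \<sigma> A B \<pi> mono in auto)
  then show ?thesis using re[of "\<lambda>j. (A j * B j) powr p"] by simp
qed

section \<open>The spectral theorem and singular values\<close>

text \<open>The characteristic polynomial has a complex root \<open>\<mu>\<close>. For an eigenvector \<open>v\<close> the number
  \<open>v\<^sup>* C v = \<mu> \<parallel>v\<parallel>\<^sup>2\<close> is its own conjugate, so \<open>\<mu>\<close> is real; then the real and the imaginary parts of
  \<open>v\<close> satisfy the eigenvector equation separately, and one of them is nonzero.\<close>

lemma real_symmetric_eigenvector:
  fixes C :: "nat \<Rightarrow> nat \<Rightarrow> real"
  assumes "0 < k" and sym: "\<And>i j. i < k \<Longrightarrow> j < k \<Longrightarrow> C i j = C j i"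
  obtains \<mu> z where "\<exists>i<k. z i \<noteq> 0" "\<And>i. i < k \<Longrightarrow> (\<Sum>j<k. C i j * z j) = \<mu> * z i"
proof -
  define M where "M = mat k k (\<lambda>(i, j). complex_of_real (C i j))"
  have M: "M \<in> carrier_mat k k" by (simp add: M_def)
  obtain as where as: "char_poly M = (\<Prod>a\<leftarrow>as. [:- a, 1:])" "length as = k"
    using char_poly_factorized[OF M] by blast
  then obtain \<mu> as' where "as = \<mu> # as'" using assms(1) by (cases as) auto
  then have "eigenvalue M \<mu>" using as by (simp add: eigenvalue_root_char_poly[OF M])
  then obtain v where v: "v \<in> carrier_vec k" "v \<noteq> 0\<^sub>v k" "M *\<^sub>v v = \<mu> \<cdot>\<^sub>v v"
    using M by (auto simp: eigenvalue_def eigenvector_def)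
  have ev: "(\<Sum>j<k. complex_of_real (C i j) * v $ j) = \<mu> * v $ i" if i: "i < k" for i
  proof -
    have "(M *\<^sub>v v) $ i = (\<mu> \<cdot>\<^sub>v v) $ i" using v by simp
    then show ?thesis using i v(1) by (simp add: M_def scalar_prod_def lessThan_atLeast0)
  qed
  obtain i0 where i0: "i0 < k" "v $ i0 \<noteq> 0"
    using v(1,2) by (metis carrier_vecD eq_vecI index_zero_vec)
  define q where "q = (\<Sum>i<k. (cmod (v $ i))\<^sup>2)"
  have q: "0 < q" unfolding q_def using i0 by (intro sum_pos2[where i = i0]) auto
  define S where "S = (\<Sum>i<k. \<Sum>j<k. cnj (v $ i) * complex_of_real (C i j) * v $ j)"
  have "S = (\<Sum>i<k. cnj (v $ i) * (\<mu> * v $ i))"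
    unfolding S_def by (intro sum.cong refl) (simp add: ev[symmetric] sum_distrib_left mult.assoc)
  also have "\<dots> = (\<Sum>i<k. \<mu> * complex_of_real ((cmod (v $ i))\<^sup>2))"
    by (intro sum.cong refl) (simp only: complex_norm_square mult_ac)
  also have "\<dots> = \<mu> * complex_of_real q" by (simp add: q_def sum_distrib_left)
  finally have S: "S = \<mu> * complex_of_real q" .
  have "cnj S = (\<Sum>i<k. \<Sum>j<k. v $ i * complex_of_real (C i j) * cnj (v $ j))"
    by (simp add: S_def)
  also have "\<dots> = (\<Sum>j<k. \<Sum>i<k. v $ i * complex_of_real (C i j) * cnj (v $ j))"
    by (rule sum.swap)
  also have "\<dots> = S"
    unfolding S_def by (intro sum.cong refl) (simp add: sym mult_ac)
  finally have "cnj \<mu> = \<mu>" using q by (simp add: S)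
  then have re: "Im \<mu> = 0" by (metis Im_complex_of_real Reals_cases Reals_cnj_iff)
  have evR: "(\<Sum>j<k. C i j * Re (v $ j)) = Re \<mu> * Re (v $ i)" if "i < k" for i
    using arg_cong[OF ev[OF that], of Re] re by (simp add: Re_sum)
  have evI: "(\<Sum>j<k. C i j * Im (v $ j)) = Re \<mu> * Im (v $ i)" if "i < k" for i
    using arg_cong[OF ev[OF that], of Im] re by (simp add: Im_sum)
  show thesis
  proof (cases "Re (v $ i0) = 0")
    case True
    then have "Im (v $ i0) \<noteq> 0" using i0 by (simp add: complex_eq_iff)
    then show ?thesis using that[of "\<lambda>i. Im (v $ i)", OF _ evI] i0 by blast
  next
    case False
    then show ?thesis using that[of "\<lambda>i. Re (v $ i)", OF _ evR] i0 by blast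
  qed
qed

text \<open>Induction on the number \<open>k\<close> of orthonormal eigenvectors found. Complete them to an orthonormal basis
  and take an eigenvector of the compression \<open>D\<close> of \<open>C\<close> to the span of the new basis vectors. Its image
  under \<open>C\<close> has no component along the old eigenvectors, by symmetry, so that it is an eigenvector of \<open>C\<close>
  itself.\<close>

theorem spectral_theorem_real_symmetric:
  fixes C :: "nat \<Rightarrow> nat \<Rightarrow> real"
  assumes sym: "\<And>i j. i < n \<Longrightarrow> j < n \<Longrightarrow> C i j = C j i"
  obtains s \<mu> where "orthonormal n n s"
    "\<And>i l. i < n \<Longrightarrow> l < n \<Longrightarrow> (\<Sum>j<n. C l j * s i j) = \<mu> i * s i l"
proof -
  have swap: "(\<Sum>l<n. x l * (\<Sum>j<n. C l j * y j)) = (\<Sum>l<n. y l * (\<Sum>j<n. C l j * x j))"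
    for x y :: "nat \<Rightarrow> real"
  proof -
    have "(\<Sum>l<n. x l * (\<Sum>j<n. C l j * y j)) = (\<Sum>l<n. \<Sum>j<n. x l * C l j * y j)"
      by (simp add: sum_distrib_left mult.assoc)
    also have "\<dots> = (\<Sum>j<n. \<Sum>l<n. x l * C l j * y j)" by (rule sum.swap)
    also have "\<dots> = (\<Sum>j<n. \<Sum>l<n. y j * (C j l * x l))"
      by (intro sum.cong refl) (simp add: sym)
    finally show ?thesis by (simp add: sum_distrib_left)
  qed
  have "\<exists>s \<mu>. orthonormal k n s \<and> (\<forall>i<k. \<forall>l<n. (\<Sum>j<n. C l j * s i j) = \<mu> i * s i l)"
    if "k \<le> n" for k
    using that
  proof (induction k)
    case 0
    then show ?case by (auto simp: orthonormal_def)
  next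
    case (Suc k)
    then obtain w \<mu> where w: "orthonormal k n w"
      and ev: "\<And>i l. i < k \<Longrightarrow> l < n \<Longrightarrow> (\<Sum>j<n. C l j * w i j) = \<mu> i * w i l" by auto
    obtain s where s: "orthonormal n n s" and sw: "\<And>i. i < k \<Longrightarrow> s i = w i"
      using orthonormal_extend[OF w] by blast
    define D where "D i j = (\<Sum>l<n. s (k + i) l * (\<Sum>m<n. C l m * s (k + j) m))" for i j
    have Dsym: "D i j = D j i" for i j unfolding D_def by (rule swap)
    have "0 < n - k" using Suc.prems by simp
    from real_symmetric_eigenvector[of "n - k" D, OF this Dsym] obtain \<nu> z where z: "\<exists>i<n-k. z i \<noteq> 0"
      and zev: "\<And>i. i < n - k \<Longrightarrow> (\<Sum>j<n-k. D i j * z j) = \<nu> * z i" by metis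
    define e where "e l = (\<Sum>i<n-k. z i * s (k + i) l)" for l
    have se: "(\<Sum>l<n. s i l * e l) = (if i < k then 0 else z (i - k))" if i: "i < n" for i
    proof -
      have "(\<Sum>l<n. s i l * e l) = (\<Sum>l<n. \<Sum>j<n-k. z j * (s i l * s (k + j) l))"
        by (simp add: e_def sum_distrib_left mult_ac)
      also have "\<dots> = (\<Sum>j<n-k. \<Sum>l<n. z j * (s i l * s (k + j) l))" by (rule sum.swap)
      also have "\<dots> = (\<Sum>j<n-k. z j * (if i = k + j then 1 else 0))"
        using i by (intro sum.cong refl) (simp add: sum_distrib_left[symmetric] orthonormalD[OF s])
      also have "\<dots> = (\<Sum>j<n-k. if j = i - k \<and> k \<le> i then z j else 0)"
        by (intro sum.cong refl) auto
      also have "\<dots> = (if i < k then 0 else z (i - k))" using i by auto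
      finally show ?thesis .
    qed
    have Ce: "(\<Sum>l<n. s i l * (\<Sum>j<n. C l j * e j)) = (\<Sum>l<n. s i l * (\<nu> * e l))" if i: "i < n" for i
    proof (cases "i < k")
      case True
      have "(\<Sum>l<n. s i l * (\<Sum>j<n. C l j * e j)) = (\<Sum>l<n. e l * (\<Sum>j<n. C l j * s i j))"
        by (rule swap)
      also have "\<dots> = (\<Sum>l<n. \<mu> i * (s i l * e l))"
        using True by (intro sum.cong refl) (simp add: sw ev)
      also have "\<dots> = 0" using se[OF i] True by (simp add: sum_distrib_left[symmetric])
      also have "\<dots> = \<nu> * (\<Sum>l<n. s i l * e l)" using se[OF i] True by simp
      finally show ?thesis by (simp add: sum_distrib_left mult_ac)
    next
      case False
      define i' where "i' = i - k"
      have i': "i = k + i'" "i' < n - k" using False i by (auto simp: i'_def)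
      have "(\<Sum>j<n. C l j * e j) = (\<Sum>j<n-k. z j * (\<Sum>m<n. C l m * s (k + j) m))" for l
        by (simp add: e_def sum_distrib_left mult_ac) (rule sum.swap)
      then have "(\<Sum>l<n. s i l * (\<Sum>j<n. C l j * e j)) =
          (\<Sum>l<n. \<Sum>j<n-k. s i l * (z j * (\<Sum>m<n. C l m * s (k + j) m)))"
        by (simp add: sum_distrib_left)
      also have "\<dots> = (\<Sum>j<n-k. \<Sum>l<n. s i l * (z j * (\<Sum>m<n. C l m * s (k + j) m)))"
        by (rule sum.swap)
      also have "\<dots> = (\<Sum>j<n-k. D i' j * z j)"
        by (simp add: D_def sum_distrib_left mult_ac i'(1))
      also have "\<dots> = \<nu> * (\<Sum>l<n. s i l * e l)" using zev[OF i'(2)] se[OF i] i' by simp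
      finally show ?thesis by (simp add: sum_distrib_left mult_ac)
    qed
    have eig: "(\<Sum>j<n. C l j * e j) = \<nu> * e l" if "l < n" for l
      by (rule orthonormal_eqI[OF s Ce that])
    define q where "q = (\<Sum>l<n. (e l)\<^sup>2)"
    have q: "0 < q"
    proof (rule ccontr)
      assume "\<not> 0 < q"
      moreover have "0 \<le> q" unfolding q_def by (intro sum_nonneg) auto
      ultimately have "q = 0" by simp
      then have e0: "\<forall>l<n. e l = 0" by (simp add: q_def sum_nonneg_eq_0_iff)
      obtain i where "i < n - k" "z i \<noteq> 0" using z by auto
      then show False using se[of "k + i"] e0 by (simp add: less_diff_conv add.commute)
    qed
    define t where "t = w(k := \<lambda>l. e l / sqrt q)"
    have we: "(\<Sum>l<n. w i l * e l) = 0" "(\<Sum>l<n. e l * w i l) = 0" if "i < k" for i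
      using se[of i] sw[OF that] that Suc.prems by (simp_all add: mult.commute)
    have "orthonormal (Suc k) n t"
      unfolding orthonormal_def
    proof (intro allI impI)
      fix i j assume "i < Suc k" "j < Suc k"
      moreover have "(\<Sum>l<n. e l / sqrt q * (e l / sqrt q)) = 1"
        using q by (simp add: sum_divide_distrib[symmetric] q_def power2_eq_square)
      ultimately show "(\<Sum>l<n. t i l * t j l) = (if i = j then 1 else 0)"
        using we orthonormalD[OF w]
        by (auto simp: t_def less_Suc_eq sum_divide_distrib[symmetric])
    qed
    moreover have "(\<Sum>j<n. C l j * t i j) = (\<mu>(k := \<nu>)) i * t i l" if "i < Suc k" "l < n" for i l
      using that ev eig by (auto simp: t_def less_Suc_eq sum_divide_distrib[symmetric])
    ultimately show ?case by blast
  qed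
  from this[of n] show thesis using that by blast
qed

text \<open>The eigenvectors diagonalize the matrix; this connects the eigenvalues of the spectral theorem, with
  their multiplicities, to the multiset of roots that defines the singular values.\<close>

lemma proots_char_poly_orthonormal_eigenbasis:
  fixes M :: "real mat"
  assumes M: "M \<in> carrier_mat n n" and s: "orthonormal n n s"
    and ev: "\<And>i l. i < n \<Longrightarrow> l < n \<Longrightarrow> (\<Sum>j<n. M $$ (l, j) * s i j) = \<mu> i * s i l"
  shows "proots (char_poly M) = mset (map \<mu> [0..<n])"
proof -
  define S where "S = mat n n (\<lambda>(l, i). s i l)"
  define D where "D = mat n n (\<lambda>(i, j). if i = j then \<mu> i else 0)"
  have S: "S \<in> carrier_mat n n" and D: "D \<in> carrier_mat n n" by (simp_all add: S_def D_def)
  have TS: "transpose_mat S * S = 1\<^sub>m n"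
    using s by (intro eq_matI) (auto simp: S_def scalar_prod_def orthonormal_def lessThan_atLeast0)
  have ST: "S * transpose_mat S = 1\<^sub>m n"
    using orthonormal_columns[OF s]
    by (intro eq_matI) (auto simp: S_def scalar_prod_def lessThan_atLeast0)
  have MS: "M * S = S * D"
  proof (rule eq_matI)
    fix l i assume "l < dim_row (S * D)" "i < dim_col (S * D)"
    then have "l < n" "i < n" using S D by auto
    then show "(M * S) $$ (l, i) = (S * D) $$ (l, i)"
      using M ev[of i l]
      by (simp add: S_def D_def scalar_prod_def lessThan_atLeast0 if_distrib mult.commute cong: if_cong)
  qed (use M S D in auto)
  have "M = M * (S * transpose_mat S)" using M ST by simp
  also have "\<dots> = S * D * transpose_mat S"
    using M S D by (simp add: MS[symmetric] assoc_mult_mat[of M n n S n "transpose_mat S" n])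
  finally have "similar_mat_wit M D S (transpose_mat S)"
    using M S D TS ST by (simp add: similar_mat_wit_def)
  then have "char_poly M = char_poly D" by (intro char_poly_similar) (auto simp: similar_mat_def)
  also have "\<dots> = (\<Prod>a\<leftarrow>diag_mat D. [:- a, 1:])"
    by (rule char_poly_upper_triangular[OF D]) (auto simp: D_def)
  also have "diag_mat D = map \<mu> [0..<n]"
    by (auto simp: diag_mat_def D_def)
  finally have cp: "char_poly M = (\<Prod>p\<leftarrow>map (\<lambda>a. [:- a, 1:]) (map \<mu> [0..<n]). p)" by simp
  have "proots (\<Prod>p\<leftarrow>map (\<lambda>a. [:- a, 1:]) as. p) = mset as" for as :: "real list"
    by (subst proots_prod_list) (auto, induction as, auto)
  then show ?thesis unfolding cp .
qed

text \<open>Take an orthonormal eigenbasis \<open>s\<^sub>i\<close> of \<open>X\<^sup>T X\<close> with eigenvalues \<open>\<mu>\<^sub>i\<close>. The images \<open>X s\<^sub>i\<close> are orthogonal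
  with squared norms \<open>\<mu>\<^sub>i\<close>. Those with \<open>\<mu>\<^sub>i = 0\<close> vanish, and the others, divided by \<open>\<surd>\<mu>\<^sub>i\<close>, are the left
  singular vectors. Only nonzero singular values are kept.\<close>

theorem singular_value_decomposition:
  fixes X :: "real mat"
  assumes X: "X \<in> carrier_mat m n"
  obtains N \<sigma> a b where "\<And>i. i < N \<Longrightarrow> 0 < \<sigma> i" "orthonormal N m a" "orthonormal N n b"
    "\<And>k l. k < m \<Longrightarrow> l < n \<Longrightarrow> X $$ (k, l) = (\<Sum>i<N. \<sigma> i * a i k * b i l)"
    "filter_mset (\<lambda>x. x \<noteq> 0) (singular_values X) = mset (map \<sigma> [0..<N])"
proof -
  define M where "M = transpose_mat X * X"
  have M: "M \<in> carrier_mat n n" using X by (simp add: M_def)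
  have Mlj: "M $$ (l, j) = (\<Sum>k<m. X $$ (k, l) * X $$ (k, j))" if "l < n" "j < n" for l j
    using X that by (simp add: M_def scalar_prod_def lessThan_atLeast0)
  obtain s \<mu> where s: "orthonormal n n s"
    and ev: "\<And>i l. i < n \<Longrightarrow> l < n \<Longrightarrow> (\<Sum>j<n. M $$ (l, j) * s i j) = \<mu> i * s i l"
    using spectral_theorem_real_symmetric[of n "\<lambda>l j. M $$ (l, j)"]
    by (auto simp: Mlj mult.commute)
  define Xs where "Xs i k = (\<Sum>l<n. X $$ (k, l) * s i l)" for i k
  have XsXs: "(\<Sum>k<m. Xs i k * Xs j k) = (if i = j then \<mu> i else 0)" if ij: "i < n" "j < n" for i j
  proof -
    have "(\<Sum>k<m. Xs i k * Xs j k) =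
        (\<Sum>k<m. \<Sum>l<n. \<Sum>q<n. s i l * (X $$ (k, l) * X $$ (k, q) * s j q))"
      by (simp add: Xs_def sum_product mult_ac)
    also have "\<dots> = (\<Sum>l<n. \<Sum>k<m. \<Sum>q<n. s i l * (X $$ (k, l) * X $$ (k, q) * s j q))"
      by (rule sum.swap)
    also have "\<dots> = (\<Sum>l<n. \<Sum>q<n. \<Sum>k<m. s i l * (X $$ (k, l) * X $$ (k, q) * s j q))"
      by (intro sum.cong refl sum.swap)
    also have "\<dots> = (\<Sum>l<n. s i l * (\<Sum>q<n. M $$ (l, q) * s j q))"
      by (intro sum.cong refl) (simp add: Mlj sum_distrib_left sum_distrib_right mult.assoc)
    also have "\<dots> = (\<Sum>l<n. \<mu> j * (s i l * s j l))"
      using ij by (intro sum.cong refl) (simp add: ev)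
    also have "\<dots> = (if i = j then \<mu> i else 0)"
      using ij by (simp add: sum_distrib_left[symmetric] orthonormalD[OF s])
    finally show ?thesis .
  qed
  have \<mu>0: "0 \<le> \<mu> i" if "i < n" for i
    using XsXs[OF that that] by (metis (no_types, lifting) sum_nonneg zero_le_square)
  have Xs0: "Xs i k = 0" if "i < n" "\<mu> i = 0" "k < m" for i k
  proof -
    have "(\<Sum>k<m. (Xs i k)\<^sup>2) = 0" using XsXs[of i i] that by (simp add: power2_eq_square)
    then show ?thesis using that by (simp add: sum_nonneg_eq_0_iff)
  qed
  \<comment> \<open>The \<open>i\<close>-th nonzero singular value belongs to the eigenvector with index \<open>js ! i\<close>.\<close>
  define js where "js = filter (\<lambda>i. \<mu> i \<noteq> 0) [0..<n]"
  define N where "N = length js"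
  have js: "js ! i < n" "\<mu> (js ! i) \<noteq> 0" if "i < N" for i
    using nth_mem[of i js] that by (auto simp: N_def js_def)
  have dist: "distinct js" by (simp add: js_def)
  have inj: "js ! i = js ! j \<longleftrightarrow> i = j" if "i < N" "j < N" for i j
    using nth_eq_iff_index_eq[OF dist] that by (simp add: N_def)
  have bij: "bij_betw ((!) js) {..<N} {i. i < n \<and> \<mu> i \<noteq> 0}"
    by (rule bij_betw_nth[OF dist]) (auto simp: N_def js_def)
  define \<sigma> where "\<sigma> i = sqrt (\<mu> (js ! i))" for i
  define b where "b i = s (js ! i)" for i
  define a where "a i k = Xs (js ! i) k / \<sigma> i" for i k
  have \<sigma>: "0 < \<sigma> i" if "i < N" for i
    using \<mu>0[OF js(1)[OF that]] js(2)[OF that] by (simp add: \<sigma>_def)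
  show thesis
  proof (rule that[of N \<sigma> a b])
    show "0 < \<sigma> i" if "i < N" for i by (rule \<sigma>[OF that])
    show "orthonormal N n b"
      using js inj orthonormalD[OF s] by (simp add: orthonormal_def b_def)
    show "orthonormal N m a"
      unfolding orthonormal_def
    proof (intro allI impI)
      fix i j assume ij: "i < N" "j < N"
      have "(\<Sum>k<m. a i k * a j k) = (\<Sum>k<m. Xs (js ! i) k * Xs (js ! j) k) / (\<sigma> i * \<sigma> j)"
        by (simp add: a_def sum_divide_distrib)
      also have "\<dots> = (if i = j then \<mu> (js ! i) else 0) / (\<sigma> i * \<sigma> j)"
        using ij js inj by (simp add: XsXs)
      also have "\<dots> = (if i = j then 1 else 0)"
        using \<mu>0[OF js(1)[OF ij(1)]] js(2)[OF ij(1)] by (cases "i = j") (simp_all add: \<sigma>_def)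
      finally show "(\<Sum>k<m. a i k * a j k) = (if i = j then 1 else 0)" .
    qed
    show "X $$ (k, l) = (\<Sum>i<N. \<sigma> i * a i k * b i l)" if kl: "k < m" "l < n" for k l
    proof -
      have "(\<Sum>i<N. \<sigma> i * a i k * b i l) = (\<Sum>i<N. Xs (js ! i) k * s (js ! i) l)"
        using \<sigma> by (intro sum.cong refl) (force simp: a_def b_def)
      also have "\<dots> = (\<Sum>i\<in>{i. i < n \<and> \<mu> i \<noteq> 0}. Xs i k * s i l)"
        by (rule sum.reindex_bij_betw[OF bij])
      also have "\<dots> = (\<Sum>i<n. Xs i k * s i l)"
        using kl Xs0 by (intro sum.mono_neutral_left) auto
      also have "\<dots> = (\<Sum>i<n. \<Sum>j<n. X $$ (k, j) * (s i j * s i l))"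
        by (simp add: Xs_def sum_distrib_right mult.assoc)
      also have "\<dots> = (\<Sum>j<n. \<Sum>i<n. X $$ (k, j) * (s i j * s i l))" by (rule sum.swap)
      also have "\<dots> = (\<Sum>j<n. X $$ (k, j) * (if j = l then 1 else 0))"
        using kl by (intro sum.cong refl)
          (simp add: sum_distrib_left[symmetric] orthonormal_columns[OF s])
      also have "\<dots> = X $$ (k, l)" using kl by (simp add: if_distrib cong: if_cong)
      finally show ?thesis by simp
    qed
    have "singular_values X = mset (map sqrt (map \<mu> [0..<n]))"
      unfolding singular_values_def M_def[symmetric]
      by (simp add: proots_char_poly_orthonormal_eigenbasis[OF M s ev] multiset.map_comp)
    then have "filter_mset (\<lambda>x. x \<noteq> 0) (singular_values X) =
        mset (filter (\<lambda>x. x \<noteq> 0) (map sqrt (map \<mu> [0..<n])))"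
      by (simp only: mset_filter)
    also have "filter (\<lambda>x. x \<noteq> 0) (map sqrt (map \<mu> [0..<n])) = map (\<lambda>i. sqrt (\<mu> i)) js"
      by (simp add: filter_map o_def js_def)
    also have "\<dots> = map \<sigma> [0..<N]"
      by (intro nth_equalityI) (simp_all add: N_def \<sigma>_def)
    finally show "filter_mset (\<lambda>x. x \<noteq> 0) (singular_values X) = mset (map \<sigma> [0..<N])" .
  qed
qed

section \<open>Factorizations and their costs\<close>

lemma l2_norm_nonneg: "0 \<le> l2_norm v"
  by (simp add: l2_norm_def scalar_prod_def sum_nonneg)

lemma l2_norm_col:
  assumes "U \<in> carrier_mat m d" "j < d"
  shows "l2_norm (col U j) = sqrt (\<Sum>k<m. (U $$ (k, j))\<^sup>2)"
  using assms by (simp add: l2_norm_def scalar_prod_def lessThan_atLeast0 power2_eq_square)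

lemma l2_norm_col_sq:
  assumes "U \<in> carrier_mat m d" "j < d"
  shows "(l2_norm (col U j))\<^sup>2 = (\<Sum>k<m. (U $$ (k, j))\<^sup>2)"
  by (simp add: l2_norm_col[OF assms] sum_nonneg)

text \<open>Each \<open>\<sigma>\<^sub>i\<close> is split evenly between the two factors, so that paired columns have equal norms: this is the
  equality case of the arithmetic-geometric mean inequality.\<close>

definition balanced_factor :: "nat \<Rightarrow> (nat \<Rightarrow> real) \<Rightarrow> (nat \<Rightarrow> nat \<Rightarrow> real) \<Rightarrow> nat \<Rightarrow> nat \<Rightarrow> real mat" where
  "balanced_factor N \<sigma> a m d = mat m d (\<lambda>(k, i). if i < N then sqrt (\<sigma> i) * a i k else 0)"

lemma balanced_factor_carrier [simp]: "balanced_factor N \<sigma> a m d \<in> carrier_mat m d"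
  by (simp add: balanced_factor_def)

lemma l2_norm_col_balanced_factor:
  assumes \<sigma>: "\<And>i. i < N \<Longrightarrow> 0 < \<sigma> i" and a: "orthonormal N m a" and i: "i < d"
  shows "l2_norm (col (balanced_factor N \<sigma> a m d) i) = (if i < N then sqrt (\<sigma> i) else 0)"
proof -
  have "(\<Sum>k<m. (balanced_factor N \<sigma> a m d $$ (k, i))\<^sup>2) = (if i < N then \<sigma> i else 0)"
  proof (cases "i < N")
    case True
    then have "(\<Sum>k<m. (balanced_factor N \<sigma> a m d $$ (k, i))\<^sup>2) = (\<Sum>k<m. \<sigma> i * (a i k * a i k))"
      using i \<sigma>[OF True] by (intro sum.cong refl)
        (simp add: balanced_factor_def power_mult_distrib power2_eq_square)
    then show ?thesis
      using True orthonormalD[OF a True True] by (simp add: sum_distrib_left[symmetric])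
  qed (use i in \<open>simp add: balanced_factor_def\<close>)
  then show ?thesis by (simp add: l2_norm_col[OF balanced_factor_carrier i])
qed

text \<open>If a factorization forces \<open>N \<le> d\<close> and the bound \<open>v\<close> is attained for all such \<open>d\<close>, then the inner minimum
  is \<open>v\<close> for \<open>d \<ge> N\<close> and \<open>\<infinity>\<close> below.\<close>

lemma min_over_factorizations_eqI:
  assumes lower: "\<And>d UV. UV \<in> factorizations X d \<Longrightarrow> N \<le> d \<and> v \<le> c d UV"
    and attained: "\<And>d. N \<le> d \<Longrightarrow> \<exists>UV \<in> factorizations X d. c d UV = v"
  shows "min_over_factorizations c X v"
proof -
  define g where "g d = (if factorizations X d = {} then \<infinity> else ereal v)" for d
  have "has_min (\<lambda>UV. ereal (c d UV)) (factorizations X d) (g d)" for d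
    using lower[of _ d] attained[of d] by (fastforce simp: has_min_def g_def)
  moreover have "has_min g {1..} (ereal v)"
  proof -
    \<comment> \<open>The outer minimum runs over \<open>d \<ge> 1\<close>, while \<open>N = 0\<close> for the zero matrix.\<close>
    have "g (max 1 N) = ereal v" using attained[of "max 1 N"] by (auto simp: g_def)
    then show ?thesis unfolding has_min_def by (auto simp: g_def intro!: bexI[of _ "max 1 N"])
  qed
  ultimately show ?thesis unfolding min_over_factorizations_def by blast
qed

lemma product_cost_le_sum_cost:
  assumes "0 < p"
  shows "product_cost p d UV \<le> sum_cost p d UV"
proof -
  obtain U V where UV: "UV = (U, V)" by force
  have le: "x powr p * y powr p \<le> 1 / 2 powr p * (x\<^sup>2 + y\<^sup>2) powr p" if "0 \<le> x" "0 \<le> y" for x y :: real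
  proof -
    have "x * y \<le> (x\<^sup>2 + y\<^sup>2) / 2" using sum_squares_bound[of x y] by simp
    then have "(x * y) powr p \<le> ((x\<^sup>2 + y\<^sup>2) / 2) powr p"
      using assms that by (intro powr_mono2) auto
    then show ?thesis using that by (simp add: powr_mult powr_divide)
  qed
  show ?thesis
    unfolding UV product_cost_def sum_cost_def prod.case sum_distrib_left
    by (intro sum_mono le l2_norm_nonneg)
qed

theorem theorem2:
  fixes p :: real and X :: "real mat" and m n r :: nat
  assumes "0 < p" and "p \<le> 1"
    and "X \<in> carrier_mat m n"
    and "vec_space.rank m X = r"
  shows "min_over_factorizations (product_cost p) X (schatten_pow p X) \<and>
         min_over_factorizations (sum_cost p) X (schatten_pow p X)"
proof -
  note X = assms(3)
  obtain N \<sigma> a b where \<sigma>: "\<And>i. i < N \<Longrightarrow> 0 < \<sigma> i"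
    and a: "orthonormal N m a" and b: "orthonormal N n b"
    and svd: "\<And>k l. k < m \<Longrightarrow> l < n \<Longrightarrow> X $$ (k, l) = (\<Sum>i<N. \<sigma> i * a i k * b i l)"
    and sv: "filter_mset (\<lambda>x. x \<noteq> 0) (singular_values X) = mset (map \<sigma> [0..<N])"
    using singular_value_decomposition[OF X] by blast
  have schatten: "schatten_pow p X = (\<Sum>i<N. \<sigma> i powr p)"
    unfolding schatten_pow_def sv
    by (simp add: sum_unfold_sum_mset lessThan_atLeast0 multiset.map_comp o_def)

  have lower: "N \<le> d \<and> schatten_pow p X \<le> product_cost p d UV" if "UV \<in> factorizations X d" for d UV
  proof -
    obtain U V where UV: "UV = (U, V)" by force
    have U: "U \<in> carrier_mat m d" and V: "V \<in> carrier_mat n d" and prod: "U * transpose_mat V = X"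
      using that X by (auto simp: factorizations_def UV)
    have Xkl: "X $$ (k, l) = (\<Sum>j<d. U $$ (k, j) * V $$ (l, j))" if "k < m" "l < n" for k l
      using U V that by (simp add: prod[symmetric] scalar_prod_def lessThan_atLeast0)
    \<comment> \<open>Coordinates of the columns with respect to the left and the right singular vectors.\<close>
    define \<alpha> where "\<alpha> i j = (\<Sum>k<m. a i k * U $$ (k, j))" for i j
    define \<beta> where "\<beta> i j = (\<Sum>l<n. b i l * V $$ (l, j))" for i j
    have "N \<le> d \<and> (\<Sum>i<N. \<sigma> i powr p) \<le> (\<Sum>j<d. (l2_norm (col U j) * l2_norm (col V j)) powr p)"
    proof (rule diagonal_factorization_bound[where \<alpha> = \<alpha> and \<beta> = \<beta>])
      fix i q assume iq: "i < N" "q < N"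
      have "(\<Sum>j<d. \<alpha> i j * \<beta> q j) =
          (\<Sum>j<d. \<Sum>k<m. \<Sum>l<n. a i k * b q l * (U $$ (k, j) * V $$ (l, j)))"
        by (simp add: \<alpha>_def \<beta>_def sum_product mult_ac)
      also have "\<dots> = (\<Sum>k<m. \<Sum>j<d. \<Sum>l<n. a i k * b q l * (U $$ (k, j) * V $$ (l, j)))"
        by (rule sum.swap)
      also have "\<dots> = (\<Sum>k<m. \<Sum>l<n. \<Sum>j<d. a i k * b q l * (U $$ (k, j) * V $$ (l, j)))"
        by (intro sum.cong refl sum.swap)
      also have "\<dots> = (\<Sum>k<m. \<Sum>l<n. a i k * b q l * (\<Sum>t<N. \<sigma> t * a t k * b t l))"
        by (intro sum.cong refl) (simp add: sum_distrib_left[symmetric] Xkl[symmetric] svd)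
      also have "\<dots> = (\<Sum>k<m. \<Sum>l<n. \<Sum>t<N. \<sigma> t * (a i k * a t k) * (b q l * b t l))"
        by (simp add: sum_distrib_left mult_ac)
      also have "\<dots> = (\<Sum>k<m. \<Sum>t<N. \<Sum>l<n. \<sigma> t * (a i k * a t k) * (b q l * b t l))"
        by (intro sum.cong refl sum.swap)
      also have "\<dots> = (\<Sum>t<N. \<Sum>k<m. \<Sum>l<n. \<sigma> t * (a i k * a t k) * (b q l * b t l))"
        by (rule sum.swap)
      also have "\<dots> = (\<Sum>t<N. \<sigma> t * (\<Sum>k<m. a i k * a t k) * (\<Sum>l<n. b q l * b t l))"
        by (simp add: sum_distrib_left sum_distrib_right mult_ac)
      also have "\<dots> = (\<Sum>t<N. if t = i then (if i = q then \<sigma> i else 0) else 0)"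
        using iq by (intro sum.cong refl) (simp add: orthonormalD[OF a] orthonormalD[OF b])
      also have "\<dots> = (if i = q then \<sigma> i else 0)" using iq by simp
      finally show "(\<Sum>j<d. \<alpha> i j * \<beta> q j) = (if i = q then \<sigma> i else 0)" .
    next
      fix j assume j: "j < d"
      show "(\<Sum>i<N. (\<alpha> i j)\<^sup>2) \<le> (l2_norm (col U j))\<^sup>2"
        using bessel_inequality[OF a] by (simp add: \<alpha>_def l2_norm_col_sq[OF U j])
      show "(\<Sum>i<N. (\<beta> i j)\<^sup>2) \<le> (l2_norm (col V j))\<^sup>2"
        using bessel_inequality[OF b] by (simp add: \<beta>_def l2_norm_col_sq[OF V j])
    qed (use assms \<sigma> l2_norm_nonneg in auto)
    then show ?thesis
      using l2_norm_nonneg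
      by (simp add: schatten UV product_cost_def powr_mult)
  qed

  have attained: "\<exists>UV \<in> factorizations X d. product_cost p d UV = schatten_pow p X \<and>
      sum_cost p d UV = schatten_pow p X" if d: "N \<le> d" for d
  proof -
    define U where "U = balanced_factor N \<sigma> a m d"
    define V where "V = balanced_factor N \<sigma> b n d"
    have U: "U \<in> carrier_mat m d" and V: "V \<in> carrier_mat n d" by (simp_all add: U_def V_def)
    have "U * transpose_mat V = X"
    proof (rule eq_matI)
      fix k l assume "k < dim_row X" "l < dim_col X"
      then have kl: "k < m" "l < n" using X by auto
      have "(U * transpose_mat V) $$ (k, l) = (\<Sum>i<d. U $$ (k, i) * V $$ (l, i))"
        using kl U V by (simp add: scalar_prod_def lessThan_atLeast0)
      also have "\<dots> = (\<Sum>i<N. U $$ (k, i) * V $$ (l, i))"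
        using d kl by (intro sum.mono_neutral_right) (auto simp: U_def balanced_factor_def)
      also have "\<dots> = (\<Sum>i<N. \<sigma> i * a i k * b i l)"
      proof (rule sum.cong[OF refl])
        fix i assume "i \<in> {..<N}"
        then have "i < N" by simp
        moreover from \<sigma>[OF this] have "sqrt (\<sigma> i) * sqrt (\<sigma> i) = \<sigma> i" by simp
        ultimately show "U $$ (k, i) * V $$ (l, i) = \<sigma> i * a i k * b i l"
          using d kl by (simp add: U_def V_def balanced_factor_def)
      qed
      also have "\<dots> = X $$ (k, l)" by (rule svd[OF kl, symmetric])
      finally show "(U * transpose_mat V) $$ (k, l) = X $$ (k, l)" .
    qed (use U V X in auto)
    then have mem: "(U, V) \<in> factorizations X d" using U V X by (simp add: factorizations_def)
    have norms: "l2_norm (col U i) = (if i < N then sqrt (\<sigma> i) else 0)"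
      "l2_norm (col V i) = (if i < N then sqrt (\<sigma> i) else 0)" if "i < d" for i
      using that l2_norm_col_balanced_factor[where \<sigma> = \<sigma>, OF \<sigma>] a b by (simp_all add: U_def V_def)
    have "product_cost p d (U, V) = (\<Sum>i<d. if i < N then \<sigma> i powr p else 0)"
      unfolding product_cost_def prod.case
      using \<sigma> by (intro sum.cong refl) (auto simp: norms powr_mult[symmetric] less_imp_le)
    moreover have "sum_cost p d (U, V) = (\<Sum>i<d. if i < N then \<sigma> i powr p else 0)"
      unfolding sum_cost_def prod.case sum_distrib_left
      using \<sigma> by (intro sum.cong refl) (auto simp: norms powr_mult less_imp_le)
    moreover have "(\<Sum>i<d. if i < N then \<sigma> i powr p else 0) = schatten_pow p X"
      unfolding schatten using d by (intro sum.mono_neutral_cong_right) auto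
    ultimately show ?thesis using mem by auto
  qed

  show ?thesis
  proof
    show "min_over_factorizations (product_cost p) X (schatten_pow p X)"
      by (rule min_over_factorizations_eqI[where N = N]) (use lower attained in blast)+
    show "min_over_factorizations (sum_cost p) X (schatten_pow p X)"
    proof (rule min_over_factorizations_eqI[where N = N])
      fix d UV assume "UV \<in> factorizations X d"
      from lower[OF this] show "N \<le> d \<and> schatten_pow p X \<le> sum_cost p d UV"
        using product_cost_le_sum_cost[OF assms(1), of d UV] by linarith
    qed (use attained in blast)
  qed
qed

end
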